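(* Let $\mathcal{H}$ be a real Hilbert space, let $\{x_i\}_{i\in I}$ be a nonempty finite subset of $\mathcal{H}$, let $\rho>0$, and let $x\in\mathcal{H}$. Set $$K:=\sum_{i\in I}\mathbb{R}_+x_i,\quad C:=K\cap S(0;\rho),\quad \kappa:=\max_{i\in I}\langle x,x_i\rangle,\quad I(x):=\{i\in I:\langle x,x_i\rangle=\kappa\}.$$ Suppose that $\|x_i\|=\rho$ for every $i\in I$. Then $$P_Cx=\begin{cases}\left\{\dfrac{\rho}{\|P_Kx\|}P_Kx\right\}, & \text{if }\kappa>0;\\[2ex] S(0;\rho)\cap\operatorname{cone}\bigl(\operatorname{conv}\{x_i\}_{i\in I(x)}\bigr), & \text{if }\kappa=0;\\[1ex] \{x_i\}_{i\in I(x)}, & \text{if }\kappa<0.\end{cases}$$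
   Context: $\mathbb{R}_+=[0,+\infty)$, and the sum defining $K$ is a Minkowski sum, so $K$ is the set of all $\sum_{i\in I}\alpha_ix_i$ with $\alpha_i\ge 0$; it is a nonempty closed convex cone. $S(0;\rho)=\{y\in\mathcal{H}:\|y\|=\rho\}$. $\operatorname{conv}$ denotes the convex hull, and $\operatorname{cone}A=\bigcup_{\lambda>0}\lambda A$ is the smallest set $B\supseteq A$ with $B=\bigcup_{\lambda>0}\lambda B$. For a nonempty subset $C$ of $\mathcal{H}$, the set-valued projector is $P_Cx=\{u\in C:\|x-u\|=\inf_{y\in C}\|x-y\|\}$; for the nonempty closed convex set $K$, $P_Kx$ is identified with its unique element. *)

theory Defs
  imports "HOL-Analysis.Analysis" "HOL-Library.Set_Algebras"
begin

definition projector :: "'a::real_normed_vector set \<Rightarrow> 'a \<Rightarrow> 'a set" where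
  "projector C x = {u \<in> C. norm (x - u) = (INF y\<in>C. norm (x - y))}"

(* The identification of a singleton-valued projector with its element; library
   closest_point is not usable because it is restricted to Heine-Borel spaces. *)
definition proj_point :: "'a::real_normed_vector set \<Rightarrow> 'a \<Rightarrow> 'a" where
  "proj_point C x = the_elem (projector C x)"

(* Strictly positive multiples only, unlike "cone hull", which also contains 0. *)
definition conical_hull :: "'a::real_vector set \<Rightarrow> 'a set" where
  "conical_hull A = (\<Union>l\<in>{0<..}. (\<lambda>a. l *\<^sub>R a) ` A)"

end

theory Submission
  imports Defs
begin

text \<open>
  All points of the sphere have the same norm, so projecting \<open>x\<close> onto a subset of the sphere
  means maximising the linear functional \<open>inner x\<close> over that subset
  (\<open>mem_projector_sphere_iff\<close>).

  If the largest value \<open>\<kappa>\<close> of this functional on the generators is not positive, the maximum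
  can be read off the coefficients. A point \<open>y = \<Sum>i\<in>I. a i *\<^sub>R X i\<close> with \<open>a i \<ge> 0\<close> and
  \<open>norm y = \<rho>\<close> has coefficient sum at least 1, by the triangle inequality
  (\<open>coefficient_sum_ge_1\<close>). Hence \<open>inner x y \<le> \<kappa> * sum a I \<le> \<kappa>\<close>, and the generators in
  \<open>Ix\<close> attain \<open>\<kappa>\<close>. Equality in the first step says that only generators in
  \<open>Ix\<close> occur in \<open>y\<close>; for \<open>\<kappa> = 0\<close> this is all there is to satisfy. For \<open>\<kappa> < 0\<close> equality
  in the second step moreover forces \<open>sum a I = 1\<close>, so that \<open>y\<close> is a convex combination of
  points of a sphere lying itself on the sphere, and therefore is one of these points
  (\<open>sphere_extreme\<close>).

  If \<open>\<kappa> > 0\<close>, let \<open>p\<close> be the projection of \<open>x\<close> onto the cone \<open>K\<close>. The variational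
  characterisation of \<open>p\<close> (\<open>ray_sum_moreau\<close>) gives
  \<open>inner x y \<le> inner p y \<le> norm p * \<rho>\<close> for \<open>y\<close> in the spherical part of \<open>K\<close>; the
  rescaling of \<open>p\<close> to norm \<open>\<rho>\<close> attains this bound, and the equality case of the
  Cauchy-Schwarz inequality makes it the only maximiser.

  The existence of \<open>p\<close> (\<open>projector_ray_sum_nonempty\<close>) follows by induction on the finite set
  of generators: either the orthogonal projection of \<open>x\<close> onto their span already lies in
  \<open>K\<close>, or the search for a nearest point can be confined to cones that omit one generator.
\<close>

section \<open>Projectors\<close>

lemma mem_projector_iff:
  "u \<in> projector C x \<longleftrightarrow> u \<in> C \<and> (\<forall>y\<in>C. norm (x - u) \<le> norm (x - y))"
proof -
  have bdd: "bdd_below ((\<lambda>y. norm (x - y)) ` C)"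
    by (rule bdd_belowI[of _ 0]) auto
  show ?thesis
  proof (intro iffI conjI ballI)
    assume u: "u \<in> projector C x"
    then show "u \<in> C" by (simp add: projector_def)
    fix y assume "y \<in> C"
    then show "norm (x - u) \<le> norm (x - y)"
      using u cINF_lower[OF bdd] by (auto simp: projector_def)
  next
    assume u: "u \<in> C \<and> (\<forall>y\<in>C. norm (x - u) \<le> norm (x - y))"
    have "norm (x - u) = (INF y\<in>C. norm (x - y))"
      using u bdd by (intro antisym cINF_greatest cINF_lower) auto
    with u show "u \<in> projector C x" by (simp add: projector_def)
  qed
qed

text \<open>
  In \<open>norm (x - y)^2 = norm x^2 - 2 * inner x y + norm y^2\<close> only the middle term varies
  along a sphere.
\<close>

lemma mem_projector_sphere_iff:
  fixes x :: "'a::real_inner"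
  assumes "C \<subseteq> sphere 0 r"
  shows "u \<in> projector C x \<longleftrightarrow> u \<in> C \<and> (\<forall>y\<in>C. inner x y \<le> inner x u)"
proof -
  have "norm (x - u) \<le> norm (x - y) \<longleftrightarrow> inner x y \<le> inner x u"
    if "u \<in> C" "y \<in> C" for y
  proof -
    have "norm u = r" "norm y = r" using assms that by auto
    then have "inner u u = inner y y"
      by (simp add: dot_square_norm)
    then show ?thesis
      by (simp add: norm_le inner_diff inner_commute)
  qed
  then show ?thesis by (auto simp: mem_projector_iff)
qed

text \<open>
  If the angle at \<open>p\<close> between \<open>x\<close> and \<open>y\<close> were acute, a short step from \<open>p\<close> towards
  \<open>y\<close>, which stays in \<open>K\<close> by convexity, would come closer to \<open>x\<close>.
\<close>

lemma nearest_point_variational: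
  fixes x :: "'a::real_inner"
  assumes "convex K" "p \<in> projector K x" "y \<in> K"
  shows "inner (x - p) (y - p) \<le> 0"
proof (rule ccontr)
  assume "\<not> ?thesis"
  then obtain t where t: "t > 0" "t \<le> 1" "dist (p + t *\<^sub>R (y - p)) x < dist p x"
    using closer_point_lemma[of x p y] by (auto simp: dist_commute)
  have "p \<in> K" using assms by (simp add: mem_projector_iff)
  then have "(1 - t) *\<^sub>R p + t *\<^sub>R y \<in> K"
    using t assms by (intro convexD) auto
  moreover have "(1 - t) *\<^sub>R p + t *\<^sub>R y = p + t *\<^sub>R (y - p)"
    by (simp add: algebra_simps)
  ultimately show False
    using assms(2) t(3) by (auto simp: mem_projector_iff dist_norm norm_minus_commute)
qed

text \<open>
  Adding the variational inequalities of two nearest points \<open>p\<close> and \<open>u\<close>, each tested at the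
  other, leaves \<open>inner (u - p) (u - p) \<le> 0\<close>.
\<close>

lemma projector_convex_singleton:
  fixes x :: "'a::real_inner"
  assumes "convex K" "p \<in> projector K x"
  shows "projector K x = {p}"
proof -
  have "u = p" if u: "u \<in> projector K x" for u
  proof -
    have "inner (x - p) (u - p) \<le> 0" "inner (x - u) (p - u) \<le> 0"
      using assms u by (auto intro: nearest_point_variational simp: mem_projector_iff)
    then have "inner (u - p) (u - p) \<le> 0"
      by (simp add: inner_diff inner_commute)
    then have "inner (u - p) (u - p) = 0"
      by (rule antisym) (rule inner_ge_zero)
    then show ?thesis unfolding inner_eq_zero_iff by simp
  qed
  with assms(2) show ?thesis by blast
qed

section \<open>Finitely generated cones\<close>

abbreviation ray_sum :: "('i \<Rightarrow> 'a::real_vector) \<Rightarrow> 'i set \<Rightarrow> 'a set" where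
  "ray_sum X I \<equiv> (\<Sum>i\<in>I. (\<lambda>a. a *\<^sub>R X i) ` {0..})"

lemma mem_ray_sum_iff:
  assumes "finite I"
  shows "y \<in> ray_sum X I \<longleftrightarrow>
    (\<exists>a. (\<forall>i\<in>I. a i \<ge> 0) \<and> y = (\<Sum>i\<in>I. a i *\<^sub>R X i))"
proof
  assume "y \<in> ray_sum X I"
  then obtain s where s: "y = sum s I" "\<forall>i\<in>I. \<exists>a\<ge>0. s i = a *\<^sub>R X i"
    unfolding set_sum_alt[OF assms] by fast
  from s(2) obtain a where "\<forall>i\<in>I. a i \<ge> 0 \<and> s i = a i *\<^sub>R X i"
    by metis
  with s(1) show "\<exists>a. (\<forall>i\<in>I. a i \<ge> 0) \<and> y = (\<Sum>i\<in>I. a i *\<^sub>R X i)"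
    by (intro exI[of _ a]) auto
next
  assume "\<exists>a. (\<forall>i\<in>I. a i \<ge> 0) \<and> y = (\<Sum>i\<in>I. a i *\<^sub>R X i)"
  then show "y \<in> ray_sum X I"
    unfolding set_sum_alt[OF assms] by auto
qed

lemma generator_mem_ray_sum:
  assumes "finite I" "i \<in> I"
  shows "X i \<in> ray_sum X I"
  unfolding mem_ray_sum_iff[OF assms(1)]
proof (intro exI conjI)
  show "X i = (\<Sum>j\<in>I. (if j = i then 1 else 0) *\<^sub>R X j)"
    using assms by (simp add: if_distrib[of "\<lambda>c. c *\<^sub>R _"] cong: if_cong)
qed auto

lemma ray_sum_mono:
  assumes "finite I" "J \<subseteq> I"
  shows "ray_sum X J \<subseteq> ray_sum X I"
proof
  have J: "finite J" using assms finite_subset by blast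
  fix y assume "y \<in> ray_sum X J"
  then obtain a where a: "\<forall>i\<in>J. a i \<ge> 0" "y = (\<Sum>i\<in>J. a i *\<^sub>R X i)"
    unfolding mem_ray_sum_iff[OF J] by auto
  have "y = (\<Sum>i\<in>I. (if i \<in> J then a i else 0) *\<^sub>R X i)"
    unfolding a(2) using assms by (intro sum.mono_neutral_cong_left) auto
  with a(1) show "y \<in> ray_sum X I"
    unfolding mem_ray_sum_iff[OF assms(1)]
    by (intro exI[of _ "\<lambda>i. if i \<in> J then a i else 0"]) auto
qed

lemma convex_cone_ray_sum:
  assumes "finite I"
  shows ray_sum_scale: "y \<in> ray_sum X I \<Longrightarrow> c \<ge> 0 \<Longrightarrow> c *\<^sub>R y \<in> ray_sum X I"
    and ray_sum_add: "y \<in> ray_sum X I \<Longrightarrow> z \<in> ray_sum X I \<Longrightarrow> y + z \<in> ray_sum X I"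
proof -
  assume y: "y \<in> ray_sum X I" and c: "c \<ge> 0"
  from y obtain a where "\<forall>i\<in>I. a i \<ge> 0" "y = (\<Sum>i\<in>I. a i *\<^sub>R X i)"
    unfolding mem_ray_sum_iff[OF assms] by auto
  with c show "c *\<^sub>R y \<in> ray_sum X I"
    unfolding mem_ray_sum_iff[OF assms]
    by (intro exI[of _ "\<lambda>i. c * a i"]) (auto simp: scaleR_sum_right)
next
  assume "y \<in> ray_sum X I" "z \<in> ray_sum X I"
  then obtain a b where ab: "\<forall>i\<in>I. a i \<ge> 0" "y = (\<Sum>i\<in>I. a i *\<^sub>R X i)"
    "\<forall>i\<in>I. b i \<ge> 0" "z = (\<Sum>i\<in>I. b i *\<^sub>R X i)"
    unfolding mem_ray_sum_iff[OF assms] by auto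
  then show "y + z \<in> ray_sum X I"
    unfolding mem_ray_sum_iff[OF assms]
    by (intro exI[of _ "\<lambda>i. a i + b i"]) (auto simp: scaleR_add_left sum.distrib)
qed

lemma convex_ray_sum:
  assumes "finite I"
  shows "convex (ray_sum X I)"
  by (auto intro!: convexI ray_sum_add[OF assms] ray_sum_scale[OF assms])

section \<open>Nearest points of finitely generated cones\<close>

text \<open>
  The orthogonal projection onto the span of the generators, written in coefficients. These
  need not be unique, since the generators may be linearly dependent or repeated; the induction
  in \<open>projector_ray_sum_nonempty\<close> works with any choice.
\<close>

lemma ex_nearest_linear_combination:
  fixes X :: "'i \<Rightarrow> 'a::real_inner"
  assumes "finite I"
  shows "\<exists>b. \<forall>a. norm (x - (\<Sum>i\<in>I. b i *\<^sub>R X i)) \<le> norm (x - (\<Sum>i\<in>I. a i *\<^sub>R X i))"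
proof -
  obtain C where C: "finite C" "span C = span (X ` I)" "pairwise orthogonal C"
    using basis_orthogonal[of "X ` I"] assms by auto
  \<comment> \<open>The Fourier expansion of \<open>x\<close> in the orthogonal set \<open>C\<close>; should \<open>0\<close> belong to \<open>C\<close>,
      its coefficient is the harmless \<open>0 / 0 = 0\<close>.\<close>
  define q where "q = (\<Sum>c\<in>C. (inner x c / inner c c) *\<^sub>R c)"
  have "inner (x - q) d = 0" if d: "d \<in> C" for d
  proof -
    have "inner q d = (\<Sum>c\<in>C. (inner x c / inner c c) * inner c d)"
      by (simp add: q_def inner_sum_left)
    also have "\<dots> = (\<Sum>c\<in>C. if c = d then inner x d else 0)"
      using C(3) d by (intro sum.cong) (auto simp: pairwise_def orthogonal_def)
    also have "\<dots> = inner x d" using C(1) d by simp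
    finally show ?thesis by (simp add: inner_diff_left)
  qed
  then have orth: "orthogonal (x - q) z" if "z \<in> span (X ` I)" for z
    using that orthogonal_to_span[of z C "x - q"] C(2) by (auto simp: orthogonal_def)
  have q: "q \<in> span (X ` I)"
    unfolding q_def C(2)[symmetric] by (intro span_sum span_scale span_base)
  have comb: "\<exists>b. z = (\<Sum>i\<in>I. b i *\<^sub>R X i)" if "z \<in> span (X ` I)" for z
    using that
  proof (induction rule: span_induct_alt)
    case base
    show ?case by (rule exI[of _ "\<lambda>_. 0"]) simp
  next
    case (step c y z)
    then obtain i b where ib: "i \<in> I" "y = X i" "z = (\<Sum>i\<in>I. b i *\<^sub>R X i)" by auto
    have "(\<Sum>j\<in>I. ((if j = i then c else 0) + b j) *\<^sub>R X j)
        = (\<Sum>j\<in>I. if j = i then c *\<^sub>R X i else 0) + z"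
      unfolding ib(3) sum.distrib[symmetric]
      by (intro sum.cong) (auto simp: scaleR_add_left)
    also have "\<dots> = c *\<^sub>R y + z" using ib assms by simp
    finally show ?case by metis
  qed
  obtain b where b: "q = (\<Sum>i\<in>I. b i *\<^sub>R X i)" using comb[OF q] by blast
  have "norm (x - q) \<le> norm (x - z)" if z: "z \<in> span (X ` I)" for z
  proof -
    have "orthogonal (x - q) (q - z)" using orth z q by (simp add: span_diff)
    from norm_add_Pythagorean[OF this]
    have "(norm (x - z))\<^sup>2 = (norm (x - q))\<^sup>2 + (norm (q - z))\<^sup>2" by simp
    then show ?thesis by (simp add: power2_le_imp_le)
  qed
  moreover have "(\<Sum>i\<in>I. a i *\<^sub>R X i) \<in> span (X ` I)" for a
    by (intro span_sum span_scale span_base) auto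
  ultimately show ?thesis using b by metis
qed

text \<open>
  A segment from the nonnegative orthant to a point outside leaves the orthant through a
  coordinate hyperplane. Coordinate \<open>i\<close>, if negative at the end point, vanishes at time
  \<open>a i / (a i - b i)\<close>, and the exit happens at the first of these times.
\<close>

lemma segment_exits_orthant:
  fixes a b :: "'i \<Rightarrow> real"
  assumes "finite I" "\<forall>i\<in>I. a i \<ge> 0" "\<exists>i\<in>I. b i < 0"
  obtains t j where "0 \<le> t" "t \<le> 1" "j \<in> I" "(1 - t) * a j + t * b j = 0"
    "\<forall>i\<in>I. (1 - t) * a i + t * b i \<ge> 0"
proof -
  define N where "N = {i\<in>I. b i < 0}"
  define s where "s i = a i / (a i - b i)" for i
  have N: "finite (s ` N)" "s ` N \<noteq> {}" using assms by (auto simp: N_def)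
  have "Min (s ` N) \<in> s ` N" by (rule Min_in[OF N])
  then obtain j where j: "j \<in> N" "s j = Min (s ` N)" by auto
  have le: "s j \<le> s i" if "i \<in> N" for i using that N j by simp
  have aj: "a j \<ge> 0" "b j < 0" "j \<in> I" using j assms by (auto simp: N_def)
  have s: "0 \<le> s j" "s j \<le> 1" using aj by (auto simp: s_def field_simps)
  have "(1 - s j) * a i + s j * b i \<ge> 0" if i: "i \<in> I" for i
  proof (cases "i \<in> N")
    case True
    then have pos: "a i - b i > 0" using assms by (auto simp: N_def)
    have "s j * (a i - b i) \<le> s i * (a i - b i)"
      using le[OF True] pos by (intro mult_right_mono) auto
    also have "\<dots> = a i" using pos by (simp add: s_def)
    finally show ?thesis by (simp add: algebra_simps)
  next
    case False
    then show ?thesis using i s assms by (auto simp: N_def)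
  qed
  moreover have "s j * (a j - b j) = a j" using aj by (simp add: s_def)
  then have "(1 - s j) * a j + s j * b j = 0" by (simp add: algebra_simps)
  ultimately show ?thesis using that[OF s aj(3)] by blast
qed

text \<open>
  Let \<open>q\<close> be the nearest point to \<open>x\<close> in the span of the generators. If the chosen coefficients
  of \<open>q\<close> are nonnegative, \<open>q\<close> lies in the cone and is nearest there. Otherwise move from an arbitrary
  point \<open>y\<close> of the cone towards \<open>q\<close>. The distance to \<open>x\<close> never exceeds its value at
  \<open>y\<close>, because it is convex along the segment and no larger at \<open>q\<close> than at \<open>y\<close>; and some
  coefficient reaches 0 before any becomes negative. So every \<open>y\<close> is matched by a point in one
  of the finitely many cones with one generator fewer, and the best of their nearest points is
  nearest in the whole cone.
\<close>

lemma projector_ray_sum_nonempty: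
  fixes X :: "'i \<Rightarrow> 'a::real_inner"
  assumes "finite I"
  shows "\<exists>p. p \<in> projector (ray_sum X I) x"
  using assms
proof (induction I rule: finite_psubset_induct)
  case (psubset I)
  note mem = mem_ray_sum_iff[OF psubset.hyps]
  obtain b where b: "norm (x - (\<Sum>i\<in>I. b i *\<^sub>R X i)) \<le> norm (x - (\<Sum>i\<in>I. a i *\<^sub>R X i))" for a
    using ex_nearest_linear_combination[OF psubset.hyps] by blast
  define q where "q = (\<Sum>i\<in>I. b i *\<^sub>R X i)"
  show ?case
  proof (cases "\<forall>i\<in>I. b i \<ge> 0")
    case True
    then have "q \<in> projector (ray_sum X I) x"
      using b by (auto simp: mem_projector_iff mem q_def)
    then show ?thesis ..
  next
    case False
    then have neg: "\<exists>i\<in>I. b i < 0" by force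
    have "\<forall>j\<in>I. \<exists>p. p \<in> projector (ray_sum X (I - {j})) x"
      using psubset.IH by (simp add: psubset_eq) blast
    then obtain p where p: "\<And>j. j \<in> I \<Longrightarrow> p j \<in> projector (ray_sum X (I - {j})) x"
      by metis
    let ?D = "(\<lambda>j. norm (x - p j)) ` I"
    have D: "finite ?D" "?D \<noteq> {}" using neg psubset.hyps by auto
    from Min_in[OF D] obtain k where k: "k \<in> I" "Min ?D = norm (x - p k)" by auto
    have k_le: "norm (x - p k) \<le> norm (x - p j)" if "j \<in> I" for j
      using Min_le[OF D(1), of "norm (x - p j)"] that k(2) by simp
    have "p k \<in> projector (ray_sum X I) x"
      unfolding mem_projector_iff
    proof (intro conjI ballI)
      show "p k \<in> ray_sum X I"
        using p[OF k(1)] ray_sum_mono[OF psubset.hyps, of "I - {k}" X]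
        by (auto simp: mem_projector_iff)
      fix y assume "y \<in> ray_sum X I"
      then obtain a where a: "\<forall>i\<in>I. a i \<ge> 0" "y = (\<Sum>i\<in>I. a i *\<^sub>R X i)"
        unfolding mem by auto
      obtain t j where t: "0 \<le> t" "t \<le> 1" "j \<in> I" "(1 - t) * a j + t * b j = 0"
        "\<forall>i\<in>I. (1 - t) * a i + t * b i \<ge> 0"
        using segment_exits_orthant[OF psubset.hyps a(1) neg] by blast
      define z where "z = (1 - t) *\<^sub>R y + t *\<^sub>R q"
      have "z = (\<Sum>i\<in>I. ((1 - t) * a i + t * b i) *\<^sub>R X i)"
        by (simp add: z_def q_def a(2) scaleR_sum_right sum.distrib scaleR_add_left)
      also have "\<dots> = (\<Sum>i\<in>I - {j}. ((1 - t) * a i + t * b i) *\<^sub>R X i)"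
        using t(4) psubset.hyps by (intro sum.mono_neutral_right) auto
      finally have "z \<in> ray_sum X (I - {j})"
        using t(5) psubset.hyps by (subst mem_ray_sum_iff) auto
      then have "norm (x - p k) \<le> norm (x - z)"
        using k_le[OF t(3)] p[OF t(3)] by (force simp: mem_projector_iff)
      also have "x - z = (1 - t) *\<^sub>R (x - y) + t *\<^sub>R (x - q)"
        by (simp add: z_def algebra_simps)
      also have "norm \<dots> \<le> (1 - t) * norm (x - y) + t * norm (x - q)"
        using t by (intro norm_triangle_le) auto
      also have "\<dots> \<le> (1 - t) * norm (x - y) + t * norm (x - y)"
        using t b[of a] by (auto simp: q_def a(2) intro!: mult_left_mono)
      finally show "norm (x - p k) \<le> norm (x - y)" by (simp add: algebra_simps)
    qed
    then show ?thesis ..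
  qed
qed

text \<open>
  The part of Moreau's decomposition that concerns the cone: \<open>x - p\<close> is orthogonal to \<open>p\<close> and
  lies in the polar cone. Testing the variational inequality at \<open>p + y\<close> and at \<open>0\<close> gives the
  two relations.
\<close>

lemma ray_sum_moreau:
  fixes X :: "'i \<Rightarrow> 'a::real_inner" and x :: 'a
  assumes "finite I"
  defines "p \<equiv> proj_point (ray_sum X I) x"
  shows "p \<in> ray_sum X I" "inner x p = inner p p"
    and "\<And>y. y \<in> ray_sum X I \<Longrightarrow> inner x y \<le> inner p y"
proof -
  obtain u where u: "u \<in> projector (ray_sum X I) x"
    using projector_ray_sum_nonempty[OF assms(1)] by blast
  then have "p = u"
    unfolding p_def proj_point_def
    by (simp add: projector_convex_singleton[OF convex_ray_sum[OF assms(1)]])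
  with u have p: "p \<in> projector (ray_sum X I) x" by simp
  then show pK: "p \<in> ray_sum X I" by (simp add: mem_projector_iff)
  note var = nearest_point_variational[OF convex_ray_sum[OF assms(1)] p]
  show le: "inner x y \<le> inner p y" if "y \<in> ray_sum X I" for y
    using var[OF ray_sum_add[OF assms(1) pK that]] by (simp add: inner_diff_left)
  have "0 \<in> ray_sum X I"
    using ray_sum_scale[OF assms(1) pK, of 0] by simp
  from var[OF this] le[OF pK] show "inner x p = inner p p"
    by (simp add: inner_diff_left)
qed

section \<open>Conical combinations of vectors on a sphere\<close>

lemma coefficient_sum_ge_1:
  fixes X :: "'i \<Rightarrow> 'a::real_normed_vector"
  assumes "\<forall>i\<in>I. a i \<ge> 0" "r > 0" "\<And>i. i \<in> I \<Longrightarrow> norm (X i) = r"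
    and "norm (\<Sum>i\<in>I. a i *\<^sub>R X i) = r"
  shows "sum a I \<ge> 1"
proof -
  have "r \<le> (\<Sum>i\<in>I. norm (a i *\<^sub>R X i))"
    using assms(4) norm_sum by metis
  also have "\<dots> = sum a I * r"
    using assms(1,3) by (simp add: sum_distrib_right)
  finally show ?thesis using \<open>r > 0\<close> by simp
qed

text \<open>
  The gap \<open>c * sum a I - (\<Sum>i\<in>I. a i * f i)\<close> is a sum of the nonnegative terms
  \<open>a i * (c - f i)\<close>, so it is nonnegative, and it vanishes only if every term does.
\<close>

lemma nonneg_sum_eq_bound:
  fixes a f :: "'i \<Rightarrow> real"
  assumes "finite I" "\<forall>i\<in>I. a i \<ge> 0" "\<And>i. i \<in> I \<Longrightarrow> f i \<le> c"
  shows "(\<Sum>i\<in>I. a i * f i) \<le> c * sum a I"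
    and "(\<Sum>i\<in>I. a i * f i) \<ge> c * sum a I \<Longrightarrow> i \<in> I \<Longrightarrow> a i \<noteq> 0 \<Longrightarrow> f i = c"
proof -
  have eq: "c * sum a I - (\<Sum>i\<in>I. a i * f i) = (\<Sum>i\<in>I. a i * (c - f i))"
    by (simp add: sum_distrib_left sum_subtractf algebra_simps)
  have nn: "\<And>i. i \<in> I \<Longrightarrow> 0 \<le> a i * (c - f i)" using assms by auto
  then have nns: "0 \<le> (\<Sum>i\<in>I. a i * (c - f i))" by (rule sum_nonneg)
  with eq show "(\<Sum>i\<in>I. a i * f i) \<le> c * sum a I" by simp
  assume "(\<Sum>i\<in>I. a i * f i) \<ge> c * sum a I" "i \<in> I" "a i \<noteq> 0"
  with eq nns have "(\<Sum>i\<in>I. a i * (c - f i)) = 0" by simp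
  then have "a i * (c - f i) = 0"
    using sum_nonneg_eq_0_iff[OF assms(1), of "\<lambda>i. a i * (c - f i)"] nn \<open>i \<in> I\<close> by blast
  with \<open>a i \<noteq> 0\<close> show "f i = c" by simp
qed

text \<open>
  Points of a sphere are extreme in the ball. Here \<open>r * r = inner y y\<close> is a weighted average
  of the numbers \<open>inner (X i) y \<le> r * r\<close>, so equality holds wherever the weight is nonzero,
  and equality means \<open>X i = y\<close>.
\<close>

lemma sphere_extreme:
  fixes X :: "'i \<Rightarrow> 'a::real_inner"
  assumes "finite I" "\<forall>i\<in>I. a i \<ge> 0" "\<And>i. i \<in> I \<Longrightarrow> norm (X i) = r"
    and y: "norm y = r" "y = (\<Sum>i\<in>I. a i *\<^sub>R X i)" and "sum a I = 1"
    and i: "i \<in> I" "a i \<noteq> 0"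
  shows "y = X i"
proof -
  have "inner (X j) y \<le> r * r" if "j \<in> I" for j
    using norm_cauchy_schwarz[of "X j" y] assms(3)[OF that] y(1) by simp
  moreover have "(\<Sum>j\<in>I. a j * inner (X j) y) = inner y y"
    by (subst (3) y(2)) (simp add: inner_sum_right inner_commute)
  then have "(\<Sum>j\<in>I. a j * inner (X j) y) = r * r * sum a I"
    using y(1) \<open>sum a I = 1\<close> by (simp add: dot_square_norm power2_eq_square)
  ultimately have "inner (X i) y = r * r"
    using nonneg_sum_eq_bound(2)[OF assms(1,2), of "\<lambda>j. inner (X j) y" "r * r" i] i by simp
  moreover have "inner (X i) (X i) = r * r" "inner y y = r * r"
    using y(1) assms(3)[OF i(1)] by (auto simp: dot_square_norm power2_eq_square)
  ultimately have "inner (y - X i) (y - X i) = 0"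
    by (simp add: inner_diff inner_commute)
  then show ?thesis by simp
qed

lemma mem_conical_hull_convex_hull:
  assumes "finite J" "\<forall>i\<in>J. a i \<ge> 0" "sum a J > 0"
  shows "(\<Sum>i\<in>J. a i *\<^sub>R X i) \<in> conical_hull (convex hull (X ` J))"
proof -
  have "(\<Sum>i\<in>J. (a i / sum a J) *\<^sub>R X i) \<in> convex hull (X ` J)"
    using assms by (intro convex_sum) (auto simp: hull_inc simp flip: sum_divide_distrib)
  moreover have "(\<Sum>i\<in>J. a i *\<^sub>R X i) = sum a J *\<^sub>R (\<Sum>i\<in>J. (a i / sum a J) *\<^sub>R X i)"
    using assms(3) by (simp add: scaleR_sum_right)
  ultimately show ?thesis
    using assms(3) by (auto simp: conical_hull_def)
qed

section \<open>Projecting onto the spherical part of the cone\<close>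

lemma projector_sphere_pos:
  fixes X :: "'i \<Rightarrow> 'a::real_inner" and x :: 'a
  assumes "finite I" "r > 0" "i \<in> I" "inner x (X i) > 0"
  defines "p \<equiv> proj_point (ray_sum X I) x"
  shows "projector (ray_sum X I \<inter> sphere 0 r) x = {(r / norm p) *\<^sub>R p}"
proof -
  note M = ray_sum_moreau[OF assms(1), where X = X and x = x, folded p_def]
  have "p \<noteq> 0"
    using M(3)[OF generator_mem_ray_sum[OF assms(1,3)]] assms(4) by auto
  then have np: "norm p > 0" by simp
  define u where "u = (r / norm p) *\<^sub>R p"
  have u: "u \<in> ray_sum X I \<inter> sphere 0 r"
    using ray_sum_scale[OF assms(1) M(1), of "r / norm p"] np \<open>r > 0\<close> by (simp add: u_def)
  have xu: "inner x u = norm p * r"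
    using M(2) np by (simp add: u_def dot_square_norm power2_eq_square)
  have le: "inner x y \<le> inner p y" "inner p y \<le> norm p * r"
    if "y \<in> ray_sum X I \<inter> sphere 0 r" for y
    using M(3)[of y] norm_cauchy_schwarz[of p y] that by auto
  have max: "v \<in> projector (ray_sum X I \<inter> sphere 0 r) x \<longleftrightarrow>
      v \<in> ray_sum X I \<inter> sphere 0 r \<and>
      (\<forall>y\<in>ray_sum X I \<inter> sphere 0 r. inner x y \<le> inner x v)" for v
    by (rule mem_projector_sphere_iff) auto
  have "v = u" if "v \<in> projector (ray_sum X I \<inter> sphere 0 r) x" for v
  proof -
    have v: "v \<in> ray_sum X I \<inter> sphere 0 r" "inner x u \<le> inner x v"
      using that u by (auto simp: max)
    then have "inner p v = norm p * norm v" using le[OF v(1)] xu by auto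
    then have "norm p *\<^sub>R v = r *\<^sub>R p" using v(1) by (simp add: norm_cauchy_schwarz_eq)
    then have "(1 / norm p) *\<^sub>R norm p *\<^sub>R v = (1 / norm p) *\<^sub>R r *\<^sub>R p" by simp
    then show ?thesis using np by (simp add: u_def)
  qed
  moreover have "u \<in> projector (ray_sum X I \<inter> sphere 0 r) x"
    unfolding max using u xu le by (metis order_trans)
  ultimately show ?thesis unfolding u_def by blast
qed

context
  fixes X :: "'i \<Rightarrow> 'a::real_inner" and I :: "'i set" and r \<kappa> :: real and x :: 'a
  assumes fin: "finite I" and r: "r > 0"
    and norm_X: "\<And>i. i \<in> I \<Longrightarrow> norm (X i) = r"
    and le_\<kappa>: "\<And>i. i \<in> I \<Longrightarrow> inner x (X i) \<le> \<kappa>"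
    and attained: "\<exists>i\<in>I. inner x (X i) = \<kappa>"
begin

text \<open>
  The value \<open>\<kappa> * sum a I\<close> bounds \<open>inner x y\<close>, and since \<open>\<kappa> \<le> 0\<close>, a coefficient sum
  above 1 can only lower it.
\<close>

lemma inner_le_of_nonpos:
  assumes "\<kappa> \<le> 0" "y \<in> ray_sum X I \<inter> sphere 0 r"
  shows "inner x y \<le> \<kappa>"
proof -
  obtain a where a: "\<forall>i\<in>I. a i \<ge> 0" "y = (\<Sum>i\<in>I. a i *\<^sub>R X i)"
    using assms(2) by (auto simp: mem_ray_sum_iff[OF fin])
  have "inner x y \<le> \<kappa> * sum a I"
    unfolding a(2) using nonneg_sum_eq_bound(1)[OF fin a(1), where f = "\<lambda>i. inner x (X i)", OF le_\<kappa>] by (simp add: inner_sum_right)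
  also have "\<dots> \<le> \<kappa> * 1"
    using coefficient_sum_ge_1[OF a(1) r norm_X] assms a(2) by (intro mult_left_mono_neg) auto
  finally show ?thesis by simp
qed

text \<open>
  For \<open>\<kappa> \<le> 0\<close> the maximum over the spherical part of the cone is the maximum over the
  generators, so it remains to describe the level set of \<open>\<kappa>\<close> there.
\<close>

lemma mem_projector_sphere_nonpos_iff:
  assumes "\<kappa> \<le> 0"
  shows "u \<in> projector (ray_sum X I \<inter> sphere 0 r) x \<longleftrightarrow>
    u \<in> ray_sum X I \<inter> sphere 0 r \<and> inner x u = \<kappa>"
proof -
  obtain i where i: "i \<in> I" "inner x (X i) = \<kappa>" using attained by blast
  then have "X i \<in> ray_sum X I \<inter> sphere 0 r"
    using generator_mem_ray_sum[OF fin] norm_X by auto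
  then show ?thesis
    using i inner_le_of_nonpos[OF assms]
    by (subst mem_projector_sphere_iff[of _ r]) (auto intro: antisym)
qed

text \<open>
  At \<open>\<kappa> = 0\<close> the size of the coefficient sum has no influence on \<open>inner x u\<close>; only its
  positivity matters, since \<open>conical_hull\<close> allows strictly positive multiples only.
\<close>

lemma projector_sphere_zero:
  assumes "\<kappa> = 0"
  shows "projector (ray_sum X I \<inter> sphere 0 r) x =
    sphere 0 r \<inter> conical_hull (convex hull (X ` {i\<in>I. inner x (X i) = \<kappa>}))"
    (is "_ = _ \<inter> conical_hull (convex hull (X ` ?J))")
proof (intro set_eqI iffI)
  fix u assume "u \<in> projector (ray_sum X I \<inter> sphere 0 r) x"
  then have u: "u \<in> ray_sum X I" "norm u = r" "inner x u = 0"
    using assms by (auto simp: mem_projector_sphere_nonpos_iff)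
  then obtain a where a: "\<forall>i\<in>I. a i \<ge> 0" "u = (\<Sum>i\<in>I. a i *\<^sub>R X i)"
    by (auto simp: mem_ray_sum_iff[OF fin])
  have "(\<Sum>i\<in>I. a i * inner x (X i)) = 0"
    using u(3) unfolding a(2) by (simp add: inner_sum_right)
  then have supp: "\<And>i. i \<in> I \<Longrightarrow> a i \<noteq> 0 \<Longrightarrow> i \<in> ?J"
    using nonneg_sum_eq_bound(2)[OF fin a(1), where f = "\<lambda>i. inner x (X i)", OF le_\<kappa>] assms by simp
  have "u = (\<Sum>i\<in>?J. a i *\<^sub>R X i)" "sum a I = sum a ?J"
    unfolding a(2) using supp fin by (auto intro!: sum.mono_neutral_right)
  moreover have "sum a I \<ge> 1"
    using coefficient_sum_ge_1[OF a(1) r norm_X] u(2) a(2) by simp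
  ultimately show "u \<in> sphere 0 r \<inter> conical_hull (convex hull (X ` ?J))"
    using mem_conical_hull_convex_hull[of ?J a X] fin a(1) u(2) by auto
next
  fix u assume u: "u \<in> sphere 0 r \<inter> conical_hull (convex hull (X ` ?J))"
  then obtain l v where v: "l > 0" "v \<in> convex hull (X ` ?J)" "u = l *\<^sub>R v"
    by (auto simp: conical_hull_def)
  have "convex hull (X ` ?J) \<subseteq> ray_sum X I \<inter> {z. inner x z = 0}"
    using assms generator_mem_ray_sum[OF fin]
    by (intro hull_minimal convex_Int convex_ray_sum[OF fin] convex_hyperplane) auto
  with v have "v \<in> ray_sum X I" "inner x v = 0" by auto
  then have "u \<in> ray_sum X I" "inner x u = 0"
    using v ray_sum_scale[OF fin, of v X l] by auto
  then show "u \<in> projector (ray_sum X I \<inter> sphere 0 r) x"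
    using u assms by (simp add: mem_projector_sphere_nonpos_iff)
qed

text \<open>
  At \<open>\<kappa> < 0\<close> a maximiser must have coefficient sum exactly 1, which by
  \<open>sphere_extreme\<close> leaves only the generators themselves.
\<close>

lemma projector_sphere_neg:
  assumes "\<kappa> < 0"
  shows "projector (ray_sum X I \<inter> sphere 0 r) x = X ` {i\<in>I. inner x (X i) = \<kappa>}"
proof (intro set_eqI iffI)
  fix u assume "u \<in> projector (ray_sum X I \<inter> sphere 0 r) x"
  then have u: "u \<in> ray_sum X I" "norm u = r" "inner x u = \<kappa>"
    using assms by (auto simp: mem_projector_sphere_nonpos_iff)
  then obtain a where a: "\<forall>i\<in>I. a i \<ge> 0" "u = (\<Sum>i\<in>I. a i *\<^sub>R X i)"
    by (auto simp: mem_ray_sum_iff[OF fin])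
  have ge: "sum a I \<ge> 1"
    using coefficient_sum_ge_1[OF a(1) r norm_X] u(2) a(2) by simp
  have "\<kappa> \<le> \<kappa> * sum a I"
    using nonneg_sum_eq_bound(1)[OF fin a(1), where f = "\<lambda>i. inner x (X i)", OF le_\<kappa>] u(3) unfolding a(2)
    by (simp add: inner_sum_right)
  then have one: "sum a I = 1" using ge assms
    by (simp add: mult_le_cancel_left1 antisym)
  then obtain i where i: "i \<in> I" "a i \<noteq> 0"
    by (metis sum.neutral zero_neq_one)
  have "u = X i"
    using sphere_extreme[OF fin a(1) norm_X u(2) a(2) one i] .
  with i u(3) show "u \<in> X ` {i\<in>I. inner x (X i) = \<kappa>}" by auto
next
  fix u assume "u \<in> X ` {i\<in>I. inner x (X i) = \<kappa>}"
  then show "u \<in> projector (ray_sum X I \<inter> sphere 0 r) x"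
    using assms generator_mem_ray_sum[OF fin] norm_X
    by (auto simp: mem_projector_sphere_nonpos_iff)
qed

end

theorem corollary8p6:
  fixes X :: "'i \<Rightarrow> 'a::{real_inner, complete_space}"
    and I :: "'i set" and \<rho> :: real and x :: 'a
  defines "K \<equiv> (\<Sum>i\<in>I. (\<lambda>a. a *\<^sub>R X i) ` {0..})"
  defines "C \<equiv> K \<inter> sphere 0 \<rho>"
  defines "\<kappa> \<equiv> Max ((\<lambda>i. inner x (X i)) ` I)"
  defines "Ix \<equiv> {i \<in> I. inner x (X i) = \<kappa>}"
  assumes "finite I" and "I \<noteq> {}"
    and "\<rho> > 0"
    and "\<And>i. i \<in> I \<Longrightarrow> norm (X i) = \<rho>"
  shows "projector C x =
    (if \<kappa> > 0 then {(\<rho> / norm (proj_point K x)) *\<^sub>R proj_point K x}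
     else if \<kappa> = 0 then sphere 0 \<rho> \<inter> conical_hull (convex hull (X ` Ix))
     else X ` Ix)"
proof -
  have le: "\<And>i. i \<in> I \<Longrightarrow> inner x (X i) \<le> \<kappa>"
    using \<open>finite I\<close> by (simp add: \<kappa>_def)
  have "\<kappa> \<in> (\<lambda>i. inner x (X i)) ` I"
    unfolding \<kappa>_def using assms(5,6) by (intro Max_in) auto
  then have att: "\<exists>i\<in>I. inner x (X i) = \<kappa>" by auto
  consider "\<kappa> > 0" | "\<kappa> = 0" | "\<kappa> < 0" by linarith
  then show ?thesis
  proof cases
    case 1
    then show ?thesis
      using att projector_sphere_pos[OF assms(5,7), of _ x X] by (auto simp: C_def K_def)
  next
    case 2
    then show ?thesis
      using projector_sphere_zero[OF assms(5,7,8) le att] by (simp add: C_def K_def Ix_def)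
  next
    case 3
    then show ?thesis
      using projector_sphere_neg[OF assms(5,7,8) le att] by (simp add: C_def K_def Ix_def)
  qed
qed

end
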